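(* Let $\mathcal{D}\in\mathbb{R}^{I_1\times\cdots\times I_N}$ and $\mathbf{A}_n\in\mathbb{R}^{I_n\times I_n}$ ($n=1,\dots,N$) be given, and assume that the Sylvester tensor equation $\mathcal{L}(\mathcal{X})=\mathcal{D}$ is consistent. Then for any initial tensor $\mathcal{X}_0\in\mathbb{R}^{I_1\times\cdots\times I_N}$, the iterates $\{\mathcal{X}_n\}$ produced by the TCORS algorithm converge to an exact solution of $\mathcal{L}(\mathcal{X})=\mathcal{D}$ in at most $M=I_1\times I_2\times\cdots\times I_N$ iteration steps without roundoff errors.
   Context: For $\mathcal{X}\in\mathbb{R}^{I_1\times\cdots\times I_N}$ and $\mathbf{A}\in\mathbb{R}^{J\times I_n}$, the $n$-mode product is $(\mathcal{X}\times_n\mathbf{A})_{i_1\dots i_{n-1}\,j\,i_{n+1}\dots i_N}=\sum_{i_n=1}^{I_n}x_{i_1\dots i_N}a_{j i_n}$. The inner product is $\langle\mathcal{X},\mathcal{Y}\rangle=\sum_{i_1,\dots,i_N}x_{i_1\dots i_N}y_{i_1\dots i_N}$. Define $\mathcal{L}(\mathcal{X})=\mathcal{X}\times_1\mathbf{A}_1+\cdots+\mathcal{X}\times_N\mathbf{A}_N$ on $\mathbb{R}^{I_1\times\cdots\times I_N}$. The equation $\mathcal{L}(\mathcal{X})=\mathcal{D}$ is consistent if it has at least one solution $\mathcal{X}\in\mathbb{R}^{I_1\times\cdots\times I_N}$. TCORS algorithm (tensor conjugate $\mathcal{L}$-orthogonal residual squared algorithm; the subscripted tensors $\mathcal{D}_n$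 below are auxiliary iterates, distinct from the right-hand side $\mathcal{D}$): given an initial guess $\mathcal{X}_0$, set $\mathcal{R}_0=\mathcal{D}-\mathcal{L}(\mathcal{X}_0)$, $\mathcal{R}_0^*=\mathcal{L}(\mathcal{R}_0)$, $\mathcal{U}_0=\mathcal{R}_0$. For $n=1,2,\dots$, until convergence: $\widehat{\mathcal{Z}}=\mathcal{L}(\mathcal{U}_{n-1})$; $\rho_{n-1}=\langle\mathcal{R}_0^*,\widehat{\mathcal{Z}}\rangle$; $\mathcal{Z}_{n-1}=\mathcal{U}_{n-1}$. If $\rho_{n-1}=0$, stop and reset the initial tensor $\mathcal{X}_0$. If $n=1$: $\mathcal{T}_0=\mathcal{U}_0$; $\mathcal{D}_0=\mathcal{T}_0$; $\mathcal{C}_0=\widehat{\mathcal{Z}}$; $\mathcal{Q}_0=\widehat{\mathcal{Z}}$. Otherwise: $\beta_{n-2}=\rho_{n-1}/\rho_{n-2}$; $\mathcal{T}_{n-1}=\mathcal{U}_{n-1}+\beta_{n-2}\mathcal{H}_{n-2}$; $\mathcal{D}_{n-1}=\mathcal{Z}_{n-1}+\beta_{n-2}\mathcal{V}_{n-2}$; $\mathcal{C}_{n-1}=\widehat{\mathcal{Z}}+\beta_{n-2}\mathcal{F}_{n-2}$; $\mathcal{Q}_{n-1}=\mathcal{C}_{n-1}+\beta_{n-2}(\mathcal{F}_{n-2}+\beta_{n-2}\mathcal{Q}_{n-2})$. Then $\widehat{\mathcal{Q}}=\mathcal{L}(\mathcal{Q}_{n-1})$; $\alpha_{n-1}=\rho_{n-1}/\langle\mathcal{R}_0^*,\widehat{\mathcal{Q}}\rangle$;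 $\mathcal{H}_{n-1}=\mathcal{T}_{n-1}-\alpha_{n-1}\mathcal{Q}_{n-1}$; $\mathcal{V}_{n-1}=\mathcal{D}_{n-1}-\alpha_{n-1}\mathcal{Q}_{n-1}$; $\mathcal{F}_{n-1}=\mathcal{C}_{n-1}-\alpha_{n-1}\widehat{\mathcal{Q}}$; $\mathcal{X}_n=\mathcal{X}_{n-1}+\alpha_{n-1}(2\mathcal{D}_{n-1}-\alpha_{n-1}\mathcal{Q}_{n-1})$; $\mathcal{U}_n=\mathcal{U}_{n-1}-\alpha_{n-1}(2\mathcal{C}_{n-1}-\alpha_{n-1}\widehat{\mathcal{Q}})$.
   Formalization: Added hypothesis: none of the first M steps breaks down (ρ = 0, or ⟨R_0*, Q̂⟩ = 0 so that α is undefined) before an exact solution is reached; without it the claim fails, e.g. N = 1, A = [[0,1],[0,0]], D = e_1, X_0 = 0. *)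

theory Defs
  imports "Jordan_Normal_Form.Matrix"
begin

text \<open>
  A real tensor of order \<open>N\<close> and size \<open>I 0 \<times> \<dots> \<times> I (N - 1)\<close> is a function on multi-indices that
  vanishes outside the index box, so that equality of tensors is equality of functions and linear
  combinations are taken pointwise. Modes and indices are counted from 0, in accordance with the
  indexing of matrices.
\<close>

type_synonym tensor = "(nat \<Rightarrow> nat) \<Rightarrow> real"

definition multi_index :: "nat \<Rightarrow> (nat \<Rightarrow> nat) \<Rightarrow> (nat \<Rightarrow> nat) set" where
  "multi_index N I = (\<Pi>\<^sub>E n\<in>{..<N}. {..<I n})"

definition tensors :: "nat \<Rightarrow> (nat \<Rightarrow> nat) \<Rightarrow> tensor set" where
  "tensors N I = {X. \<forall>i. i \<notin> multi_index N I \<longrightarrow> X i = 0}"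

definition tensor_inner :: "nat \<Rightarrow> (nat \<Rightarrow> nat) \<Rightarrow> tensor \<Rightarrow> tensor \<Rightarrow> real" where
  "tensor_inner N I X Y = (\<Sum>i\<in>multi_index N I. X i * Y i)"

text \<open>
  For \<open>B\<close> of size \<open>J \<times> I n\<close>, the \<open>n\<close>-mode product has size \<open>J\<close> instead of \<open>I n\<close> in mode \<open>n\<close>.
\<close>

definition mode_prod :: "nat \<Rightarrow> (nat \<Rightarrow> nat) \<Rightarrow> nat \<Rightarrow> tensor \<Rightarrow> real mat \<Rightarrow> tensor" where
  "mode_prod N I n X B =
     (\<lambda>i. if i \<in> multi_index N (I(n := dim_row B))
          then \<Sum>k<I n. X (i(n := k)) * B $$ (i n, k) else 0)"

definition sylvester_op :: "nat \<Rightarrow> (nat \<Rightarrow> nat) \<Rightarrow> (nat \<Rightarrow> real mat) \<Rightarrow> tensor \<Rightarrow> tensor" where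
  "sylvester_op N I A X = (\<lambda>i. \<Sum>n<N. mode_prod N I n X (A n) i)"

definition sylvester_consistent ::
  "nat \<Rightarrow> (nat \<Rightarrow> nat) \<Rightarrow> (nat \<Rightarrow> real mat) \<Rightarrow> tensor \<Rightarrow> bool" where
  "sylvester_consistent N I A D \<longleftrightarrow> (\<exists>X\<in>tensors N I. sylvester_op N I A X = D)"

text \<open>
  The state after \<open>n\<close> iteration steps holds \<open>X\<^sub>n\<close>, \<open>U\<^sub>n\<close> and the quantities
  \<open>\<rho>\<close>, \<open>H\<close>, \<open>V\<close>, \<open>F\<close>, \<open>Q\<close> with subscript \<open>n - 1\<close> that the next step refers to.
\<close>

record tcors_state =
  st_X :: tensor
  st_U :: tensor
  st_rho :: real
  st_H :: tensor
  st_V :: tensor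
  st_F :: tensor
  st_Q :: tensor

text \<open>
  The \<open>n\<close>-th iteration step, for \<open>n \<ge> 1\<close>, where \<open>L\<close> is the linear operator, \<open>ip\<close> the inner product
  and \<open>Rs\<close> is \<open>L R\<^sub>0\<close>. The result is \<open>None\<close> if the step breaks down, i.e. if \<open>\<rho> = 0\<close> (the stopping
  test of the algorithm) or if the denominator of \<open>\<alpha>\<close> vanishes, so that \<open>\<alpha>\<close> is undefined.
\<close>

definition tcors_step ::
  "(tensor \<Rightarrow> tensor) \<Rightarrow> (tensor \<Rightarrow> tensor \<Rightarrow> real) \<Rightarrow> tensor \<Rightarrow> nat \<Rightarrow> tcors_state \<Rightarrow>
   tcors_state option" where
  "tcors_step L ip Rs n s =
    (let X = st_X s; U = st_U s; Zh = L U; \<rho> = ip Rs Zh; Z = U in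
     if \<rho> = 0 then None
     else
       let (T, D, C, Q) =
         (if n = 1 then (U, U, Zh, Zh)
          else
            let \<beta> = \<rho> / st_rho s;
                T = (\<lambda>i. U i + \<beta> * st_H s i);
                D = (\<lambda>i. Z i + \<beta> * st_V s i);
                C = (\<lambda>i. Zh i + \<beta> * st_F s i);
                Q = (\<lambda>i. C i + \<beta> * (st_F s i + \<beta> * st_Q s i))
            in (T, D, C, Q));
         Qh = L Q;
         \<sigma> = ip Rs Qh
       in
       if \<sigma> = 0 then None
       else
         let \<alpha> = \<rho> / \<sigma> in
         Some \<lparr>st_X = (\<lambda>i. X i + \<alpha> * (2 * D i - \<alpha> * Q i)),
               st_U = (\<lambda>i. U i - \<alpha> * (2 * C i - \<alpha> * Qh i)),
               st_rho = \<rho>,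
               st_H = (\<lambda>i. T i - \<alpha> * Q i),
               st_V = (\<lambda>i. D i - \<alpha> * Q i),
               st_F = (\<lambda>i. C i - \<alpha> * Qh i),
               st_Q = Q\<rparr>)"

text \<open>
  Only \<open>st_X\<close> and \<open>st_U\<close> of the initial state are meaningful; the first step ignores the other fields.
\<close>

definition tcors_init ::
  "nat \<Rightarrow> (nat \<Rightarrow> nat) \<Rightarrow> (nat \<Rightarrow> real mat) \<Rightarrow> tensor \<Rightarrow> tensor \<Rightarrow> tcors_state" where
  "tcors_init N I A D X0 =
     \<lparr>st_X = X0, st_U = (\<lambda>i. D i - sylvester_op N I A X0 i), st_rho = 0,
      st_H = (\<lambda>_. 0), st_V = (\<lambda>_. 0), st_F = (\<lambda>_. 0), st_Q = (\<lambda>_. 0)\<rparr>"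

text \<open>
  \<open>tcors N I A D X0 n = Some s\<close> means that \<open>n\<close> steps are carried out, with resulting state \<open>s\<close>.
  In exact arithmetic, iterating until convergence means iterating until \<open>X\<^sub>n\<close> solves the equation.
  The value is \<open>None\<close> if the algorithm has stopped before completing the \<open>n\<close>-th step, either because
  of convergence or because of a breakdown.
\<close>

primrec tcors ::
  "nat \<Rightarrow> (nat \<Rightarrow> nat) \<Rightarrow> (nat \<Rightarrow> real mat) \<Rightarrow> tensor \<Rightarrow> tensor \<Rightarrow> nat \<Rightarrow> tcors_state option" where
  "tcors N I A D X0 0 = Some (tcors_init N I A D X0)"
| "tcors N I A D X0 (Suc n) =
     (case tcors N I A D X0 n of
        None \<Rightarrow> None
      | Some s \<Rightarrow>
          if sylvester_op N I A (st_X s) = D then None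
          else tcors_step (sylvester_op N I A) (tensor_inner N I)
                 (sylvester_op N I A (st_U (tcors_init N I A D X0))) (Suc n) s)"

definition tcors_breakdown ::
  "nat \<Rightarrow> (nat \<Rightarrow> nat) \<Rightarrow> (nat \<Rightarrow> real mat) \<Rightarrow> tensor \<Rightarrow> tensor \<Rightarrow> nat \<Rightarrow> bool" where
  "tcors_breakdown N I A D X0 n \<longleftrightarrow>
     (\<exists>s. tcors N I A D X0 n = Some s \<and> sylvester_op N I A (st_X s) \<noteq> D \<and>
          tcors N I A D X0 (Suc n) = None)"

end

theory Submission
  imports Defs "Jordan_Normal_Form.Determinant"
begin

text \<open>
  Put \<open>L\<close> for the Sylvester operator, \<open>R\<^sub>0\<close> for the initial residual, and consider the linear functional
  \<open>c p = \<langle>L R\<^sub>0, p(L) R\<^sub>0\<rangle>\<close> on real polynomials. It determines two sequences of polynomials: the residual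
  polynomials \<open>\<phi>\<^sub>n\<close> and the direction polynomials \<open>\<psi>\<^sub>n\<close> of the biconjugate residual method. Every
  tensor of the algorithm is a product of two of these, possibly times \<open>x\<close>, evaluated at \<open>L\<close> and
  applied to \<open>R\<^sub>0\<close>; above all \<open>U\<^sub>n = \<phi>\<^sub>n(L)\<^sup>2 R\<^sub>0\<close>, \<open>\<rho>\<^sub>n = c (x \<phi>\<^sub>n\<^sup>2)\<close>, and the denominator of \<open>\<alpha>\<^sub>n\<close> is
  \<open>\<sigma>\<^sub>n = c (x\<^sup>2 \<psi>\<^sub>n\<^sup>2)\<close> (\<open>tracks_step\<close>). Moreover \<open>U\<^sub>n\<close> is the true residual \<open>D - L X\<^sub>n\<close>.

  As long as no \<open>\<rho>\<close> or \<open>\<sigma>\<close> vanishes, the \<open>\<phi>\<^sub>n\<close> are orthogonal for the symmetric bilinear form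
  \<open>(p, q) \<mapsto> c (x p q)\<close>, and the \<open>\<psi>\<^sub>n\<close> for \<open>(p, q) \<mapsto> c (x\<^sup>2 p q)\<close> (\<open>res_dir_orthogonal\<close>). Suppose that \<open>M\<close>
  steps are carried out, where \<open>M\<close> is the dimension of the tensor space. The \<open>M + 1\<close> tensors
  \<open>\<phi>\<^sub>j(L) R\<^sub>0\<close> with \<open>j \<le> M\<close> satisfy a nontrivial linear relation. Pairing it with \<open>\<phi>\<^sub>k\<close> for \<open>k < M\<close>
  isolates \<open>\<rho>\<^sub>k \<noteq> 0\<close> times the \<open>k\<close>-th coefficient, so that only the coefficient of \<open>\<phi>\<^sub>M(L) R\<^sub>0\<close> survives
  and \<open>\<phi>\<^sub>M(L) R\<^sub>0 = 0\<close> (\<open>res_poly_annihilates\<close>). Then \<open>U\<^sub>M = \<phi>\<^sub>M(L)\<^sup>2 R\<^sub>0 = 0\<close>, i.e. \<open>X\<^sub>M\<close> is a solution.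
  If instead fewer than \<open>M\<close> steps are carried out without a breakdown, the run has ended because it
  has reached a solution.
\<close>

section \<open>Conjugate residual polynomials of a linear functional\<close>

locale poly_functional =
  fixes c :: "'a::field poly \<Rightarrow> 'a"
  assumes c_add: "c (p + q) = c p + c q"
    and c_smult: "c (smult a p) = a * c p"
begin

lemma c_0: "c 0 = 0"
  using c_smult[of 0 0] by simp

lemma c_diff: "c (p - q) = c p - c q"
  using c_add[of "p - q" q] by simp

lemma c_sum: "c (\<Sum>j\<in>J. p j) = (\<Sum>j\<in>J. c (p j))"
  by (induction J rule: infinite_finite_induct) (simp_all add: c_0 c_add)

text \<open>
  \<open>res_poly\<close> and \<open>dir_poly\<close> are \<open>\<phi>\<close> and \<open>\<psi>\<close>, with \<open>\<phi>\<^sub>n\<^sub>+\<^sub>1 = \<phi>\<^sub>n - \<alpha>\<^sub>n x \<psi>\<^sub>n\<close> and \<open>\<psi>\<^sub>n\<^sub>+\<^sub>1 = \<phi>\<^sub>n\<^sub>+\<^sub>1 + \<beta>\<^sub>n \<psi>\<^sub>n\<close>. The scalars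
  \<open>\<alpha>\<^sub>n\<close> and \<open>\<beta>\<^sub>n\<close> are spelled out in terms of \<open>c\<close>, so that the recursion depends on nothing but \<open>c\<close>.
\<close>

function res_poly :: "nat \<Rightarrow> 'a poly" and dir_poly :: "nat \<Rightarrow> 'a poly" where
  "res_poly 0 = 1"
| "res_poly (Suc n) = res_poly n
     - smult (c ([:0, 1:] * res_poly n ^ 2) / c ([:0, 1:] ^ 2 * dir_poly n ^ 2))
         ([:0, 1:] * dir_poly n)"
| "dir_poly 0 = 1"
| "dir_poly (Suc n) = res_poly (Suc n)
     + smult (c ([:0, 1:] * res_poly (Suc n) ^ 2) / c ([:0, 1:] * res_poly n ^ 2)) (dir_poly n)"
  by pat_completeness auto
termination
  by (relation "measure (case_sum (\<lambda>n. 2 * n) (\<lambda>n. 2 * n + 1))") auto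

definition rho :: "nat \<Rightarrow> 'a" where
  "rho n = c ([:0, 1:] * res_poly n ^ 2)"

definition sigma :: "nat \<Rightarrow> 'a" where
  "sigma n = c ([:0, 1:] ^ 2 * dir_poly n ^ 2)"

lemma res_poly_Suc:
  "res_poly (Suc n) = res_poly n - smult (rho n / sigma n) ([:0, 1:] * dir_poly n)"
  by (simp add: rho_def sigma_def)

lemma dir_poly_Suc:
  "dir_poly (Suc n) = res_poly (Suc n) + smult (rho (Suc n) / rho n) (dir_poly n)"
  by (simp add: rho_def)

lemmas [simp del] = res_poly.simps(2) dir_poly.simps(2)

text \<open>
  Both orthogonalities are proved together, because the recurrences translate each into the other:
  \<open>\<phi>\<^sub>i\<close> is a combination of \<open>\<psi>\<^sub>i\<close> and \<open>\<psi>\<^sub>i\<^sub>-\<^sub>1\<close>, while \<open>x \<psi>\<^sub>i\<close> is a multiple of \<open>\<phi>\<^sub>i - \<phi>\<^sub>i\<^sub>+\<^sub>1\<close> since \<open>\<alpha>\<^sub>i \<noteq> 0\<close>. For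
  \<open>i < n\<close> each new pairing reduces to pairings already known to vanish; for \<open>i = n\<close> the values of \<open>\<alpha>\<^sub>n\<close> and \<open>\<beta>\<^sub>n\<close> are
  exactly those that cancel the remaining terms.
\<close>

lemma res_dir_orthogonal:
  assumes "\<forall>i<n. rho i \<noteq> 0 \<and> sigma i \<noteq> 0"
  shows "\<forall>j\<le>n. \<forall>i<j. c ([:0, 1:] * (res_poly i * res_poly j)) = 0 \<and>
           c ([:0, 1:] ^ 2 * (dir_poly i * dir_poly j)) = 0"
  using assms
proof (induction n)
  case 0
  show ?case by simp
next
  case (Suc n)
  let ?x = "[:0, 1:] :: 'a poly"
  have nz: "rho i \<noteq> 0" "sigma i \<noteq> 0" if "i \<le> n" for i
    using Suc.prems that by auto
  have IH: "c (?x * (res_poly i * res_poly n)) = 0"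
    "c (?x ^ 2 * (dir_poly i * dir_poly n)) = 0" if "i < n" for i
    using Suc that by auto
  have res_dir: "c (?x ^ 2 * (res_poly i * dir_poly n)) = (if i = n then sigma n else 0)"
    if "i \<le> n" for i
  proof (cases i)
    case 0
    then have "res_poly i = dir_poly i" by simp
    then show ?thesis using IH(2)[of i] that
      by (auto simp: sigma_def power2_eq_square)
  next
    case (Suc k)
    have "?x ^ 2 * (res_poly i * dir_poly n) = ?x ^ 2 * (dir_poly i * dir_poly n)
        - smult (rho (Suc k) / rho k) (?x ^ 2 * (dir_poly k * dir_poly n))"
      unfolding Suc dir_poly_Suc[of k] by (simp add: algebra_simps)
    then have "c (?x ^ 2 * (res_poly i * dir_poly n)) = c (?x ^ 2 * (dir_poly i * dir_poly n))
        - rho (Suc k) / rho k * c (?x ^ 2 * (dir_poly k * dir_poly n))"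
      by (simp only: c_diff c_smult)
    then show ?thesis
      using IH(2)[of i] IH(2)[of k] that Suc
      by (auto simp: sigma_def power2_eq_square)
  qed
  have res: "c (?x * (res_poly i * res_poly (Suc n))) = 0" if "i \<le> n" for i
  proof -
    have "?x * (res_poly i * res_poly (Suc n)) = ?x * (res_poly i * res_poly n)
        - smult (rho n / sigma n) (?x ^ 2 * (res_poly i * dir_poly n))"
      unfolding res_poly_Suc[of n] by (simp add: algebra_simps power2_eq_square)
    then have "c (?x * (res_poly i * res_poly (Suc n))) = c (?x * (res_poly i * res_poly n))
        - rho n / sigma n * c (?x ^ 2 * (res_poly i * dir_poly n))"
      by (simp only: c_diff c_smult)
    then show ?thesis
      using that IH(1)[of i] res_dir[of i] nz[of n]
      by (auto simp: rho_def power2_eq_square)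
  qed
  have dir: "c (?x ^ 2 * (dir_poly i * dir_poly (Suc n))) = 0" if "i \<le> n" for i
  proof -
    have x_dir: "?x * dir_poly i = smult (sigma i / rho i) (res_poly i - res_poly (Suc i))"
      using nz[OF that] by (simp add: res_poly_Suc)
    have "?x ^ 2 * (dir_poly i * dir_poly (Suc n)) = ?x * ((?x * dir_poly i) * res_poly (Suc n))
        + smult (rho (Suc n) / rho n) (?x ^ 2 * (dir_poly i * dir_poly n))"
      unfolding dir_poly_Suc[of n] by (simp add: algebra_simps power2_eq_square)
    also have "?x * ((?x * dir_poly i) * res_poly (Suc n)) = smult (sigma i / rho i)
        (?x * (res_poly i * res_poly (Suc n)) - ?x * (res_poly (Suc i) * res_poly (Suc n)))"
      unfolding x_dir by (simp add: algebra_simps smult_diff_right)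
    finally have "c (?x ^ 2 * (dir_poly i * dir_poly (Suc n))) =
        sigma i / rho i * (c (?x * (res_poly i * res_poly (Suc n)))
          - c (?x * (res_poly (Suc i) * res_poly (Suc n))))
        + rho (Suc n) / rho n * c (?x ^ 2 * (dir_poly i * dir_poly n))"
      by (simp only: c_add c_diff c_smult)
    then show ?thesis
      using that res[OF that] res[of "Suc i"] IH(2)[of i] nz[of n]
      by (cases "i = n") (auto simp: rho_def sigma_def power2_eq_square)
  qed
  show ?case
  proof (intro allI impI)
    fix j i assume "j \<le> Suc n" "i < j"
    then show "c (?x * (res_poly i * res_poly j)) = 0 \<and>
        c (?x ^ 2 * (dir_poly i * dir_poly j)) = 0"
      using Suc res[of i] dir[of i] by (cases "j = Suc n") auto
  qed
qed

end

section \<open>Polynomials in a linear operator on real-valued functions\<close>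

locale linear_fun_op =
  fixes L :: "('i \<Rightarrow> real) \<Rightarrow> 'i \<Rightarrow> real"
  assumes L_lincomb: "L (\<lambda>i. a * X i + b * Y i) = (\<lambda>i. a * L X i + b * L Y i)"
begin

lemma L_0: "L (\<lambda>i. 0) = (\<lambda>i. 0)"
  using L_lincomb[of 0 undefined 0 undefined] by simp

lemma L_add: "L (\<lambda>i. X i + Y i) = (\<lambda>i. L X i + L Y i)"
  using L_lincomb[of 1 X 1 Y] by simp

lemma L_diff: "L (\<lambda>i. X i - Y i) = (\<lambda>i. L X i - L Y i)"
  using L_lincomb[of 1 X "-1" Y] by simp

lemma L_scale: "L (\<lambda>i. a * X i) = (\<lambda>i. a * L X i)"
  using L_lincomb[of a X 0 undefined] by simp

text \<open>
  Horner's scheme, so that induction on the polynomial matches the evaluation at \<open>L\<close>.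
\<close>

definition poly_op :: "real poly \<Rightarrow> ('i \<Rightarrow> real) \<Rightarrow> 'i \<Rightarrow> real" where
  "poly_op p v = fold_coeffs (\<lambda>a w i. a * v i + L w i) p (\<lambda>i. 0)"

lemma poly_op_0 [simp]: "poly_op 0 v = (\<lambda>i. 0)"
  by (simp add: poly_op_def)

lemma poly_op_pCons: "poly_op (pCons a p) v = (\<lambda>i. a * v i + L (poly_op p v) i)"
  by (cases "a = 0 \<and> p = 0") (auto simp: poly_op_def L_0)

lemma poly_op_1: "poly_op 1 v = v"
  by (simp add: one_pCons poly_op_pCons L_0)

lemma poly_op_smult: "poly_op (smult a p) v = (\<lambda>i. a * poly_op p v i)"
  by (induction p) (simp_all add: poly_op_pCons L_scale algebra_simps)

lemma poly_op_add: "poly_op (p + q) v = (\<lambda>i. poly_op p v i + poly_op q v i)"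
  by (induction p q rule: poly_induct2) (simp_all add: poly_op_pCons L_add algebra_simps)

lemma poly_op_diff: "poly_op (p - q) v = (\<lambda>i. poly_op p v i - poly_op q v i)"
  using poly_op_add[of "p - q" q v] by (simp add: fun_eq_iff)

lemma poly_op_sum: "poly_op (\<Sum>j\<in>J. p j) v = (\<lambda>i. \<Sum>j\<in>J. poly_op (p j) v i)"
  by (induction J rule: infinite_finite_induct) (simp_all add: poly_op_add)

lemma poly_op_mult: "poly_op (p * q) v = poly_op p (poly_op q v)"
  by (induction p) (simp_all add: poly_op_pCons poly_op_add poly_op_smult)

lemma poly_op_x_mult: "poly_op ([:0, 1:] * p) v = L (poly_op p v)"
  by (simp add: poly_op_pCons)

lemma poly_op_zero: "poly_op p (\<lambda>i. 0) = (\<lambda>i. 0)"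
  by (induction p) (simp_all add: poly_op_pCons L_0)

lemma poly_op_support:
  assumes "\<And>X i. \<forall>i. i \<notin> S \<longrightarrow> X i = 0 \<Longrightarrow> i \<notin> S \<Longrightarrow> L X i = 0"
    and "\<forall>i. i \<notin> S \<longrightarrow> v i = 0"
  shows "\<forall>i. i \<notin> S \<longrightarrow> poly_op p v i = 0"
  by (induction p) (use assms in \<open>auto simp: poly_op_pCons\<close>)

end

section \<open>Linear relations in a finite-dimensional space\<close>

text \<open>
  One vector more than the dimension: the values on \<open>S\<close> fill all rows but one of a square matrix.
  Completed by a row of zeros, the matrix is singular, and a kernel vector holds the coefficients.
\<close>

lemma nontrivial_relation:
  fixes v :: "nat \<Rightarrow> 'i \<Rightarrow> 'a::field"
  assumes "finite S"
  obtains b where "\<exists>j\<le>card S. b j \<noteq> 0" and "\<And>i. i \<in> S \<Longrightarrow> (\<Sum>j\<le>card S. b j * v j i) = 0"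
proof -
  let ?M = "card S"
  obtain e where e: "bij_betw e {0..<?M} S"
    using assms ex_bij_betw_nat_finite by blast
  define G where "G = mat (Suc ?M) (Suc ?M) (\<lambda>(k, j). if k < ?M then v j (e k) else 0)"
  have G: "G \<in> carrier_mat (Suc ?M) (Suc ?M)"
    by (simp add: G_def)
  (* The zero row of G is a zero column of its transpose. *)
  have "transpose_mat G *\<^sub>v unit_vec (Suc ?M) ?M = 0\<^sub>v (Suc ?M)"
    by (rule eq_vecI) (auto simp: G_def scalar_prod_right_unit)
  moreover have "unit_vec (Suc ?M) ?M \<noteq> (0\<^sub>v (Suc ?M) :: 'a vec)"
    by (simp add: unit_vec_nonzero)
  ultimately have "det (transpose_mat G) = 0"
    using G det_0_iff_vec_prod_zero_field[of "transpose_mat G" "Suc ?M"]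
    by (metis transpose_carrier_mat unit_vec_carrier)
  then have "det G = 0"
    using G by (simp add: det_transpose)
  then obtain w where w: "w \<in> carrier_vec (Suc ?M)" "w \<noteq> 0\<^sub>v (Suc ?M)" "G *\<^sub>v w = 0\<^sub>v (Suc ?M)"
    using det_0_iff_vec_prod_zero_field[OF G] by auto
  show thesis
  proof
    show "\<exists>j\<le>?M. w $ j \<noteq> 0"
    proof (rule ccontr)
      assume "\<not> ?thesis"
      then have "w = 0\<^sub>v (Suc ?M)"
        using w(1) by (intro eq_vecI) auto
      with w(2) show False ..
    qed
    fix i assume "i \<in> S"
    then obtain k where k: "k < ?M" "e k = i"
      using e by (force simp: bij_betw_def)
    have "0 = (G *\<^sub>v w) $ k"
      using k w(3) by simp
    also have "\<dots> = (\<Sum>j\<le>?M. w $ j * v j i)"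
      using k w(1) by (simp add: G_def scalar_prod_def mult.commute lessThan_Suc_atMost atLeast0LessThan)
    finally show "(\<Sum>j\<le>?M. w $ j * v j i) = 0" ..
  qed
qed

section \<open>Termination by dimension\<close>

text \<open>
  A linear functional \<open>f\<close> on the function space, evaluated along the Krylov space of \<open>r\<close>, is a linear
  functional on polynomials. For the algorithm, \<open>f\<close> is the inner product with \<open>L R\<^sub>0\<close> and \<open>r\<close> is \<open>R\<^sub>0\<close>.
\<close>

locale krylov_functional = linear_fun_op L for L :: "('i \<Rightarrow> real) \<Rightarrow> 'i \<Rightarrow> real" +
  fixes f :: "('i \<Rightarrow> real) \<Rightarrow> real" and r :: "'i \<Rightarrow> real"
  assumes f_lincomb: "f (\<lambda>i. a * X i + b * Y i) = a * f X + b * f Y"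
begin

sublocale poly_functional "\<lambda>p. f (poly_op p r)"
proof
  show "f (poly_op (p + q) r) = f (poly_op p r) + f (poly_op q r)" for p q
    using f_lincomb[of 1 _ 1] by (simp add: poly_op_add)
  show "f (poly_op (smult a p) r) = a * f (poly_op p r)" for a p
    using f_lincomb[of a _ 0] by (simp add: poly_op_smult)
qed

text \<open>
  The \<open>\<phi>\<^sub>j(L) r\<close> with \<open>j \<le> card S\<close> are too many to be independent. A relation between them is a
  polynomial \<open>p\<close> with \<open>p(L) r = 0\<close>, whence \<open>c (x \<phi>\<^sub>k p) = 0\<close> for all \<open>k\<close>; orthogonality reads off from this
  that all coefficients but the last vanish.
\<close>

lemma res_poly_annihilates:
  assumes "finite S"
    and "\<And>X i. \<forall>i. i \<notin> S \<longrightarrow> X i = 0 \<Longrightarrow> i \<notin> S \<Longrightarrow> L X i = 0"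
    and "\<forall>i. i \<notin> S \<longrightarrow> r i = 0"
    and nz: "\<forall>i<card S. rho i \<noteq> 0 \<and> sigma i \<noteq> 0"
  shows "poly_op (res_poly (card S)) r = (\<lambda>i. 0)"
proof -
  let ?M = "card S"
  obtain b where b: "\<exists>j\<le>?M. b j \<noteq> 0"
    and rel: "\<And>i. i \<in> S \<Longrightarrow> (\<Sum>j\<le>?M. b j * poly_op (res_poly j) r i) = 0"
    using nontrivial_relation[OF assms(1), of "\<lambda>j. poly_op (res_poly j) r"] by blast
  define p where "p = (\<Sum>j\<le>?M. smult (b j) (res_poly j))"
  have p_sum: "poly_op p r = (\<lambda>i. \<Sum>j\<le>?M. b j * poly_op (res_poly j) r i)"
    by (simp add: p_def poly_op_sum poly_op_smult)
  have p_r: "poly_op p r = (\<lambda>i. 0)"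
  proof
    fix i show "poly_op p r i = 0"
      using poly_op_support[of S r p, OF assms(2,3)] rel[of i] p_sum
      by (cases "i \<in> S") auto
  qed
  have b_0: "b k = 0" if "k < ?M" for k
  proof -
    have "f (\<lambda>i. 0) = 0"
      using f_lincomb[of 0 undefined 0 undefined] by simp
    then have "0 = f (poly_op (([:0, 1:] * res_poly k) * p) r)"
      by (simp only: poly_op_mult p_r poly_op_zero)
    also have "([:0, 1:] * res_poly k) * p
        = (\<Sum>j\<le>?M. smult (b j) ([:0, 1:] * (res_poly k * res_poly j)))"
      unfolding p_def sum_distrib_left by (simp only: mult_smult_right mult.assoc)
    also have "f (poly_op \<dots> r)
        = (\<Sum>j\<le>?M. b j * f (poly_op ([:0, 1:] * (res_poly k * res_poly j)) r))"
      by (simp only: c_sum c_smult)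
    also have "\<dots> = (\<Sum>j\<le>?M. if j = k then b k * rho k else 0)"
    proof (rule sum.cong[OF refl])
      fix j assume j: "j \<in> {..?M}"
      consider "j = k" | "j < k" | "k < j" by linarith
      then show "b j * f (poly_op ([:0, 1:] * (res_poly k * res_poly j)) r)
          = (if j = k then b k * rho k else 0)"
      proof cases
        case 1
        then show ?thesis by (simp add: rho_def power2_eq_square)
      next
        case 2
        have "f (poly_op ([:0, 1:] * (res_poly j * res_poly k)) r) = 0"
          using res_dir_orthogonal[OF nz] 2 that less_imp_le by blast
        then show ?thesis using 2 by (simp only: mult.commute[of "res_poly j"]) simp
      next
        case 3
        have "f (poly_op ([:0, 1:] * (res_poly k * res_poly j)) r) = 0"
          using res_dir_orthogonal[OF nz] 3 j by blast
        then show ?thesis using 3 by (simp only:) simp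
      qed
    qed
    also have "\<dots> = b k * rho k"
      using that by simp
    finally show ?thesis
      using nz that by auto
  qed
  have "b ?M \<noteq> 0"
    using b b_0 by (metis le_neq_implies_less)
  moreover have "b ?M * poly_op (res_poly ?M) r i = 0" for i
  proof -
    have "(\<Sum>j\<le>?M. b j * poly_op (res_poly j) r i) = b ?M * poly_op (res_poly ?M) r i"
      by (subst sum.remove[of _ ?M]) (auto simp: b_0)
    then show ?thesis
      using fun_cong[OF p_r, of i] unfolding p_sum by simp
  qed
  ultimately show ?thesis by auto
qed

end


section \<open>The iterates as squares of polynomials in the operator\<close>

locale tcors_run = krylov_functional L "ip Rs" R0
  for L :: "tensor \<Rightarrow> tensor" and ip :: "tensor \<Rightarrow> tensor \<Rightarrow> real" and Rs R0 :: tensor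
begin

text \<open>
  The polynomial form of a state after \<open>n\<close> steps, together with the absence of breakdowns so far. The
  fields with subscript \<open>n - 1\<close> carry no information when \<open>n = 0\<close>.
\<close>

definition tracks :: "nat \<Rightarrow> tcors_state \<Rightarrow> bool" where
  "tracks n s \<longleftrightarrow>
     (\<forall>i<n. rho i \<noteq> 0 \<and> sigma i \<noteq> 0) \<and>
     st_U s = poly_op (res_poly n ^ 2) R0 \<and>
     (\<forall>k. n = Suc k \<longrightarrow>
        st_rho s = rho k \<and>
        st_H s = poly_op (res_poly n * dir_poly k) R0 \<and>
        st_V s = poly_op (res_poly n * dir_poly k) R0 \<and>
        st_F s = poly_op ([:0, 1:] * (res_poly n * dir_poly k)) R0 \<and>
        st_Q s = poly_op ([:0, 1:] * dir_poly k ^ 2) R0)"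

text \<open>
  Multiplying out \<open>\<phi>\<^sub>n\<psi>\<^sub>n\<close>, \<open>\<psi>\<^sub>n\<^sup>2\<close>, \<open>\<phi>\<^sub>n\<^sub>+\<^sub>1\<psi>\<^sub>n\<close> and \<open>\<phi>\<^sub>n\<^sub>+\<^sub>1\<^sup>2\<close> by the recurrences gives the update formulas of
  the algorithm. The second part says that the updates of \<open>X\<close> and \<open>U\<close> fit together, so that \<open>L X + U\<close>
  does not change and \<open>U\<close> stays the residual of \<open>X\<close>.
\<close>

lemma tracks_step:
  assumes "tracks n s" and "tcors_step L ip Rs (Suc n) s = Some s'"
  shows "tracks (Suc n) s'"
    and "\<exists>p. st_X s' = (\<lambda>i. st_X s i + poly_op p R0 i) \<and>
             st_U s' = (\<lambda>i. st_U s i - L (poly_op p R0) i)"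
proof -
  let ?P = "\<lambda>p. poly_op p R0"
  let ?x = "[:0, 1:] :: real poly"
  let ?f = "res_poly n" and ?d = "dir_poly n"
  define a where "a = rho n / sigma n"
  have U: "st_U s = ?P (?f ^ 2)"
    using assms(1) by (simp add: tracks_def)
  have LU: "L (st_U s) = ?P (?x * ?f ^ 2)"
    by (simp only: U poly_op_x_mult)
  have rho: "ip Rs (L (st_U s)) = rho n"
    by (simp only: LU rho_def)
  (* The tensors T, D, C, Q of the step are phi psi, phi psi, x phi psi, x psi^2 applied to R0. *)
  have dirs: "(if Suc n = 1 then (st_U s, st_U s, L (st_U s), L (st_U s))
     else (\<lambda>i. st_U s i + rho n / st_rho s * st_H s i,
           \<lambda>i. st_U s i + rho n / st_rho s * st_V s i,
           \<lambda>i. L (st_U s) i + rho n / st_rho s * st_F s i,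
           \<lambda>i. L (st_U s) i + rho n / st_rho s * st_F s i
                + rho n / st_rho s * (st_F s i + rho n / st_rho s * st_Q s i)))
    = (?P (?f * ?d), ?P (?f * ?d), ?P (?x * (?f * ?d)), ?P (?x * ?d ^ 2))"
  proof (cases n)
    case 0
    then have "?f = 1" "?d = 1" by simp_all
    moreover have "L (?P 1) = ?P ?x"
      using poly_op_x_mult[of 1 R0] by simp
    ultimately show ?thesis
      using 0 by (simp add: U)
  next
    case (Suc k)
    define b where "b = rho n / rho k"
    have st: "st_rho s = rho k" "st_H s = ?P (?f * dir_poly k)" "st_V s = ?P (?f * dir_poly k)"
      "st_F s = ?P (?x * (?f * dir_poly k))" "st_Q s = ?P (?x * dir_poly k ^ 2)"
      using assms(1) Suc by (simp_all add: tracks_def)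
    have d: "?d = ?f + smult b (dir_poly k)"
      using dir_poly_Suc[of k] by (simp add: Suc b_def)
    have fd: "?f * ?d = ?f ^ 2 + smult b (?f * dir_poly k)"
      unfolding d by (simp add: algebra_simps power2_eq_square)
    have xfd: "?x * (?f * ?d) = ?x * ?f ^ 2 + smult b (?x * (?f * dir_poly k))"
      unfolding fd by (simp add: algebra_simps)
    have xdd: "?x * ?d ^ 2 = ?x * (?f * ?d) + smult b (?x * (?f * dir_poly k)
        + smult b (?x * dir_poly k ^ 2))"
      unfolding d by (simp add: algebra_simps power2_eq_square smult_add_right)
    have D: "?P (?f ^ 2) i + b * ?P (?f * dir_poly k) i = ?P (?f * ?d) i" for i
      by (simp only: fd poly_op_add poly_op_smult)
    have C: "?P (?x * ?f ^ 2) i + b * ?P (?x * (?f * dir_poly k)) i = ?P (?x * (?f * ?d)) i" for i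
      by (simp only: xfd poly_op_add poly_op_smult)
    have Q: "?P (?x * (?f * ?d)) i + b * (?P (?x * (?f * dir_poly k)) i
          + b * ?P (?x * dir_poly k ^ 2) i) = ?P (?x * ?d ^ 2) i" for i
      by (simp only: xdd poly_op_add poly_op_smult)
    have "(Suc n = 1) = False"
      using Suc by simp
    then show ?thesis
      by (simp only: if_False LU st b_def[symmetric]) (simp only: U D C Q)
  qed
  have sigma: "ip Rs (L (?P (?x * ?d ^ 2))) = sigma n"
    by (simp only: sigma_def poly_op_x_mult[symmetric] mult.assoc[symmetric] power2_eq_square)
  have "tcors_step L ip Rs (Suc n) s =
    (if rho n = 0 then None else if sigma n = 0 then None else
       Some \<lparr>st_X = (\<lambda>i. st_X s i + a * (2 * ?P (?f * ?d) i - a * ?P (?x * ?d ^ 2) i)),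
             st_U = (\<lambda>i. st_U s i - a * (2 * ?P (?x * (?f * ?d)) i - a * L (?P (?x * ?d ^ 2)) i)),
             st_rho = rho n,
             st_H = (\<lambda>i. ?P (?f * ?d) i - a * ?P (?x * ?d ^ 2) i),
             st_V = (\<lambda>i. ?P (?f * ?d) i - a * ?P (?x * ?d ^ 2) i),
             st_F = (\<lambda>i. ?P (?x * (?f * ?d)) i - a * L (?P (?x * ?d ^ 2)) i),
             st_Q = ?P (?x * ?d ^ 2)\<rparr>)"
    by (simp only: tcors_step_def Let_def rho) (simp only: dirs prod.case sigma a_def)
  with assms(2) have nz: "rho n \<noteq> 0" "sigma n \<noteq> 0"
    and s': "s' = \<lparr>st_X = (\<lambda>i. st_X s i + a * (2 * ?P (?f * ?d) i - a * ?P (?x * ?d ^ 2) i)),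
             st_U = (\<lambda>i. st_U s i - a * (2 * ?P (?x * (?f * ?d)) i - a * L (?P (?x * ?d ^ 2)) i)),
             st_rho = rho n,
             st_H = (\<lambda>i. ?P (?f * ?d) i - a * ?P (?x * ?d ^ 2) i),
             st_V = (\<lambda>i. ?P (?f * ?d) i - a * ?P (?x * ?d ^ 2) i),
             st_F = (\<lambda>i. ?P (?x * (?f * ?d)) i - a * L (?P (?x * ?d ^ 2)) i),
             st_Q = ?P (?x * ?d ^ 2)\<rparr>"
    by (auto split: if_splits)
  have f: "res_poly (Suc n) = ?f - smult a (?x * ?d)"
    by (simp only: res_poly_Suc a_def)
  have H: "(\<lambda>i. ?P (?f * ?d) i - a * ?P (?x * ?d ^ 2) i) = ?P (res_poly (Suc n) * ?d)"
  proof -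
    have "res_poly (Suc n) * ?d = ?f * ?d - smult a (?x * ?d ^ 2)"
      unfolding f by (simp add: algebra_simps power2_eq_square)
    then show ?thesis by (simp only: poly_op_diff poly_op_smult)
  qed
  have F: "(\<lambda>i. ?P (?x * (?f * ?d)) i - a * L (?P (?x * ?d ^ 2)) i)
      = ?P (?x * (res_poly (Suc n) * ?d))"
    by (simp only: poly_op_x_mult H[symmetric] L_diff L_scale)
  (* The increment of X is p(L) R0, where x p = phi_n^2 - phi_(n+1)^2. *)
  define p where "p = smult a (smult 2 (?f * ?d) - smult a (?x * ?d ^ 2))"
  have X': "st_X s' = (\<lambda>i. st_X s i + ?P p i)"
    by (simp only: s' p_def poly_op_diff poly_op_smult) simp
  have Lp: "L (?P p) = (\<lambda>i. a * (2 * ?P (?x * (?f * ?d)) i - a * L (?P (?x * ?d ^ 2)) i))"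
    by (simp only: p_def poly_op_diff poly_op_smult L_diff L_scale poly_op_x_mult)
  then have U': "st_U s' = (\<lambda>i. st_U s i - L (?P p) i)"
    by (simp only: s') simp
  have two: "smult 2 q = q + q" for q :: "real poly"
    using smult_add_left[of 1 1 q] by simp
  have "?f ^ 2 - ?x * p = res_poly (Suc n) ^ 2"
    unfolding f p_def two by (simp add: algebra_simps power2_eq_square smult_add_right smult_diff_right)
  moreover have "(\<lambda>i. st_U s i - L (?P p) i) = ?P (?f ^ 2 - ?x * p)"
    by (simp only: U poly_op_diff poly_op_x_mult)
  ultimately have U'_sq: "st_U s' = ?P (res_poly (Suc n) ^ 2)"
    by (simp only: U')
  show "tracks (Suc n) s'"
    unfolding tracks_def
  proof (intro conjI allI impI)
    fix i assume "i < Suc n"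
    then show "rho i \<noteq> 0" "sigma i \<noteq> 0"
      using assms(1) nz by (auto simp: tracks_def less_Suc_eq)
  next
    show "st_U s' = ?P (res_poly (Suc n) ^ 2)" by (fact U'_sq)
  qed (auto simp only: s' tcors_state.simps H F nat.inject)
  show "\<exists>p. st_X s' = (\<lambda>i. st_X s i + poly_op p R0 i) \<and>
             st_U s' = (\<lambda>i. st_U s i - L (poly_op p R0) i)"
    using X' U' by blast
qed

end

section \<open>The Sylvester operator\<close>

lemma linear_fun_op_sylvester: "linear_fun_op (sylvester_op N I A)"
proof
  fix a b and X Y :: tensor
  have mode: "mode_prod N I n (\<lambda>i. a * X i + b * Y i) B i
      = a * mode_prod N I n X B i + b * mode_prod N I n Y B i" for n B i
    by (simp add: mode_prod_def algebra_simps sum.distrib sum_distrib_left)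
  show "sylvester_op N I A (\<lambda>i. a * X i + b * Y i)
      = (\<lambda>i. a * sylvester_op N I A X i + b * sylvester_op N I A Y i)"
    by (simp add: sylvester_op_def mode sum.distrib sum_distrib_left)
qed

lemma tensor_inner_lincomb:
  "tensor_inner N I Z (\<lambda>i. a * X i + b * Y i) = a * tensor_inner N I Z X + b * tensor_inner N I Z Y"
  by (simp add: tensor_inner_def algebra_simps sum.distrib sum_distrib_left)

lemma sylvester_op_in_tensors:
  assumes "\<forall>n<N. A n \<in> carrier_mat (I n) (I n)"
  shows "sylvester_op N I A X \<in> tensors N I"
proof -
  have "I(n := dim_row (A n)) = I" if "n < N" for n
    using assms that by auto
  then show ?thesis
    by (auto simp: tensors_def sylvester_op_def mode_prod_def intro!: sum.neutral)
qed

lemma finite_multi_index: "finite (multi_index N I)"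
  by (simp add: multi_index_def finite_PiE)

lemma card_multi_index: "card (multi_index N I) = (\<Prod>k<N. I k)"
  by (simp add: multi_index_def card_PiE)

section \<open>Convergence within the dimension of the tensor space\<close>

theorem theorem2:
  fixes N :: nat and I :: "nat \<Rightarrow> nat" and A :: "nat \<Rightarrow> real mat" and D X0 :: tensor
  assumes "N \<ge> 1" and "\<forall>n<N. I n \<ge> 1"
    and "D \<in> tensors N I"
    and "\<forall>n<N. A n \<in> carrier_mat (I n) (I n)"
    and "sylvester_consistent N I A D"
    and "X0 \<in> tensors N I"
    and no_breakdown: "\<forall>n < (\<Prod>k<N. I k). \<not> tcors_breakdown N I A D X0 n"
  shows "\<exists>m \<le> (\<Prod>k<N. I k). \<exists>s. tcors N I A D X0 m = Some s \<and>
           st_X s \<in> tensors N I \<and> sylvester_op N I A (st_X s) = D"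
proof -
  let ?L = "sylvester_op N I A" and ?ip = "tensor_inner N I"
  let ?S = "multi_index N I"
  define R0 where "R0 = st_U (tcors_init N I A D X0)"
  interpret linear_fun_op ?L
    by (rule linear_fun_op_sylvester)
  interpret tcors_run ?L ?ip "?L R0" R0
    by unfold_locales (rule tensor_inner_lincomb)
  have R0: "R0 = (\<lambda>i. D i - ?L X0 i)"
    by (simp add: R0_def tcors_init_def)
  have R0_supp: "\<forall>i. i \<notin> ?S \<longrightarrow> R0 i = 0"
    using assms(3) sylvester_op_in_tensors[OF assms(4)] by (simp add: R0 tensors_def)
  have L_supp: "?L X i = 0" if "i \<notin> ?S" for X i
    using sylvester_op_in_tensors[OF assms(4)] that by (simp add: tensors_def)
  have inv: "tracks n s \<and> st_X s \<in> tensors N I \<and> st_U s = (\<lambda>i. D i - ?L (st_X s) i)"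
    if "tcors N I A D X0 n = Some s" for n s
    using that
  proof (induction n arbitrary: s)
    case 0
    then have s: "s = tcors_init N I A D X0" by simp
    have "st_U s = R0" by (simp add: s R0_def)
    moreover from this have "tracks 0 s" by (simp add: tracks_def poly_op_1)
    moreover have "st_X s = X0" by (simp add: s tcors_init_def)
    ultimately show ?case
      using assms(6) by (simp add: R0)
  next
    case (Suc n)
    then obtain t where t: "tcors N I A D X0 n = Some t"
      and step: "tcors_step ?L ?ip (?L R0) (Suc n) t = Some s"
      by (auto simp: R0_def split: option.splits if_splits)
    note IH = Suc.IH[OF t]
    obtain p where X: "st_X s = (\<lambda>i. st_X t i + poly_op p R0 i)"
      and U: "st_U s = (\<lambda>i. st_U t i - ?L (poly_op p R0) i)"
      using tracks_step(2)[OF _ step] IH by blast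
    have "st_X s \<in> tensors N I"
      using IH poly_op_support[OF L_supp R0_supp, of p] by (simp add: X tensors_def)
    moreover have "st_U s = (\<lambda>i. D i - ?L (st_X s) i)"
      using IH by (simp add: U X L_add algebra_simps)
    ultimately show ?case
      using tracks_step(1)[OF _ step] IH by blast
  qed
  (* Without a breakdown, the run can only end early at a solution. *)
  have run: "(\<exists>m<n. \<exists>s. tcors N I A D X0 m = Some s \<and> ?L (st_X s) = D) \<or>
      (\<exists>s. tcors N I A D X0 n = Some s)" if "n \<le> card ?S" for n
    using that
  proof (induction n)
    case 0
    show ?case by simp
  next
    case (Suc n)
    then show ?case
      using no_breakdown unfolding tcors_breakdown_def card_multi_index
      by (metis Suc_le_eq less_Suc_eq not_None_eq less_imp_le)
  qed
  from run[OF order_refl] show ?thesis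
  proof
    assume "\<exists>m<card ?S. \<exists>s. tcors N I A D X0 m = Some s \<and> ?L (st_X s) = D"
    then obtain m s where "m < card ?S" and "tcors N I A D X0 m = Some s" and "?L (st_X s) = D"
      by blast
    with inv[of m s] show ?thesis
      unfolding card_multi_index by (intro exI[of _ m] exI[of _ s]) auto
  next
    assume "\<exists>s. tcors N I A D X0 (card ?S) = Some s"
    then obtain s where s: "tcors N I A D X0 (card ?S) = Some s" ..
    note inv_s = inv[OF s]
    then have "poly_op (res_poly (card ?S)) R0 = (\<lambda>i. 0)"
      by (intro res_poly_annihilates[OF finite_multi_index L_supp R0_supp])
        (auto simp: tracks_def)
    then have "st_U s = (\<lambda>i. 0)"
      using inv_s by (simp add: tracks_def power2_eq_square poly_op_mult poly_op_zero)
    then have "?L (st_X s) = D"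
      using inv_s by (auto simp: fun_eq_iff)
    then show ?thesis
      using s inv_s unfolding card_multi_index by blast
  qed
qed

end
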